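(* Let $p$ be a prime, let $k>0$ be an integer, and let $G = C_{p^k}(S)$ be a circulant graph on $n=p^k$ vertices with $\emptyset \neq S \subseteq \{1,\ldots,\lfloor n/2\rfloor\}$ (i.e. $G$ has at least one edge). Then the reduced Euler characteristic of the independence complex of $G$ is nonzero: $\widetilde{\chi}(\Delta(G)) \neq 0$.
   Context: For $S \subseteq \{1,\ldots,\lfloor n/2\rfloor\}$, the circulant graph $C_n(S)$ is the simple graph with vertex set $\mathbb{Z}_n=\{0,\ldots,n-1\}$ and edge set $\{\{i,j\} : |j-i|_n \in S\}$, where $|k|_n=\min\{|k|, n-|k|\}$. The independence complex $\Delta(G)$ is the simplicial complex whose faces are the independent sets of $G$ (sets of pairwise non-adjacent vertices). If $f_{i-1}$ denotes the number of independent sets of cardinality $i$ (so $f_{-1}=1$, corresponding to the empty set) and $d$ is the maximum cardinality of an independent set, the reduced Euler characteristic is $\widetilde{\chi}(\Delta(G))=\sum_{i=0}^{d}(-1)^{i-1}f_{i-1}$. *)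

theory Defs
  imports "HOL-Library.Ramsey" "HOL-Computational_Algebra.Primes"
begin

type_synonym 'a graph = "'a set \<times> 'a set set"

abbreviation vertices :: "'a graph \<Rightarrow> 'a set" where
  "vertices \<equiv> fst"

abbreviation edges :: "'a graph \<Rightarrow> 'a set set" where
  "edges \<equiv> snd"

definition circ_abs :: "nat \<Rightarrow> int \<Rightarrow> int" where
  "circ_abs n k = min \<bar>k\<bar> (int n - \<bar>k\<bar>)"

text \<open>The vertices of \<open>\<int>\<^sub>n\<close> are the representatives \<open>0, \<dots>, n - 1\<close>, and \<open>j - i\<close> is their
  integer difference, so that \<open>\<bar>j - i\<bar> < n\<close>.\<close>

definition circulant_graph :: "nat \<Rightarrow> int set \<Rightarrow> int graph" where
  "circulant_graph n S =
     ({0..<int n}, {{i, j} | i j. i \<in> {0..<int n} \<and> j \<in> {0..<int n} \<and> circ_abs n (j - i) \<in> S})"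

lemma circulant_graph_simple:
  assumes "S \<subseteq> {1..int (n div 2)}"
  shows "edges (circulant_graph n S) \<subseteq> [vertices (circulant_graph n S)]\<^bsup>2\<^esup>"
proof
  fix e assume "e \<in> edges (circulant_graph n S)"
  then obtain i j where e: "e = {i, j}" "i \<in> {0..<int n}" "j \<in> {0..<int n}"
    "circ_abs n (j - i) \<in> S"
    by (auto simp: circulant_graph_def)
  with assms have "i \<noteq> j"
    by (auto simp: circ_abs_def)
  with e show "e \<in> [vertices (circulant_graph n S)]\<^bsup>2\<^esup>"
    by (auto simp: circulant_graph_def nsets_def)
qed

text \<open>A simplicial complex is represented by its set of faces, the empty face included.\<close>

definition independence_complex :: "'a graph \<Rightarrow> 'a set set" where
  "independence_complex G = {F. F \<subseteq> vertices G \<and> indep F (edges G)}"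

text \<open>The number of faces of cardinality \<open>i\<close>, that is, the entry \<open>f\<^bsub>i-1\<^esub>\<close> of the f-vector.\<close>

definition num_faces :: "'a set set \<Rightarrow> nat \<Rightarrow> nat" where
  "num_faces \<Delta> i = card {F \<in> \<Delta>. card F = i}"

text \<open>The sign \<open>(-1)\<^bsup>i-1\<^esup>\<close> is written with the exponent \<open>i + 1\<close>, which has the same parity
  and is a natural number also for \<open>i = 0\<close>. The definition is meant for finite nonempty complexes,
  for which the maximum exists.\<close>

definition reduced_euler_char :: "'a set set \<Rightarrow> int" where
  "reduced_euler_char \<Delta> = (\<Sum>i = 0..Max (card ` \<Delta>). (-1) ^ (i + 1) * int (num_faces \<Delta> i))"

end

theory Submission
  imports Defs "HOL-Number_Theory.Cong"
begin

text \<open>Rotation by one generates an action of the group \<open>\<int>\<^sub>n\<close>, a \<open>p\<close>-group, on the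
  independent sets that preserves cardinalities. The sum of signs defining the reduced Euler
  characteristic is therefore congruent modulo \<open>p\<close> to its restriction to the fixed points. Since
  rotation is transitive on vertices, only the empty set and the full vertex set can be fixed, and
  the latter is not independent as \<open>G\<close> has an edge. So the characteristic is \<open>-1\<close> modulo \<open>p\<close>.\<close>

lemma funpow_closed: "f ` X \<subseteq> X \<Longrightarrow> x \<in> X \<Longrightarrow> (f ^^ m) x \<in> X"
  by (induction m) auto

lemma funpow_mult_fixpoint: "(f ^^ m) x = x \<Longrightarrow> (f ^^ (m * l)) x = x"
  by (induction l) (auto simp: funpow_add)

text \<open>Bezout's identity in the subtraction-free form \<open>a * u = b * v + 1\<close> makes a
  multiple of \<open>a\<close> exceed a multiple of \<open>b\<close> by a single application of
  \<open>f\<close>; \<open>a > 0\<close> guarantees such naturals exist.\<close>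

lemma coprime_period_fixpoint:
  assumes "(f ^^ a) x = x" "(f ^^ b) x = x" "coprime a b" "a > 0"
  shows "f x = x"
proof -
  obtain u v where "a * u = b * v + 1"
    using bezout_nat[of a b] assms(3,4) by (auto simp: coprime_iff_gcd_eq_1)
  then have "(f ^^ (a * u)) x = f ((f ^^ (b * v)) x)"
    by simp
  then show ?thesis
    using assms(1,2) by (simp add: funpow_mult_fixpoint)
qed

text \<open>If the iterates at \<open>i < j\<close> agreed, \<open>p - j + i\<close> would be a
  period strictly between 0 and \<open>p\<close>, hence coprime to \<open>p\<close>, and
  \<open>x\<close> would be a fixed point.\<close>

lemma inj_on_prime_period:
  assumes p: "prime (p::nat)" and x: "(f ^^ p) x = x" "f x \<noteq> x"
  shows "inj_on (\<lambda>i. (f ^^ i) x) {..<p}"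
proof (rule linorder_inj_onI)
  fix i j assume ij: "i < j" "i \<in> {..<p}" "j \<in> {..<p}"
  show "(f ^^ i) x \<noteq> (f ^^ j) x"
  proof
    assume eq: "(f ^^ i) x = (f ^^ j) x"
    have "(f ^^ (p - j + i)) x = (f ^^ (p - j + j)) x"
      unfolding funpow_add using eq by simp
    then have "(f ^^ (p - j + i)) x = x"
      using ij x by simp
    moreover have "coprime p (p - j + i)"
      using ij p by (intro prime_imp_coprime) (auto dest: dvd_imp_le)
    ultimately show False
      using coprime_period_fixpoint[of p f x] x prime_gt_0_nat[OF p] by blast
  qed
qed auto

text \<open>Strong induction on \<open>X\<close>, removing one nontrivial orbit at a time: it has
  exactly \<open>p\<close> elements and \<open>g\<close> is constant on it, so its sum vanishes
  modulo \<open>p\<close>.\<close>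

lemma sum_cong_fixpoints_prime:
  fixes g :: "'a \<Rightarrow> int"
  assumes p: "prime (p::nat)" and "finite X" "f ` X \<subseteq> X"
    and "\<And>x. x \<in> X \<Longrightarrow> (f ^^ p) x = x" and "\<And>x. x \<in> X \<Longrightarrow> g (f x) = g x"
  shows "[sum g X = sum g {x \<in> X. f x = x}] (mod int p)"
  using assms(2-)
proof (induction X rule: finite_psubset_induct)
  case (psubset X)
  show ?case
  proof (cases "\<exists>x \<in> X. f x \<noteq> x")
    case False
    then have "{x \<in> X. f x = x} = X" by auto
    then show ?thesis by simp
  next
    case True
    then obtain x where x: "x \<in> X" "f x \<noteq> x" by blast
    define B where "B = (\<lambda>i. (f ^^ i) x) ` {..<p}"
    \<comment> \<open>Exponents matter only modulo \<open>p\<close>. The indices below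
      \<open>p\<close> serve for counting, the full range for closure under
      \<open>f\<close>.\<close>
    have B_eq: "B = range (\<lambda>i. (f ^^ i) x)"
    proof
      have "(f ^^ i) x \<in> B" for i
        using funpow_mod_eq[where f = f and n = p and x = x and m = i] psubset.prems(2)[OF x(1)]
          prime_gt_0_nat[OF p]
        by (metis B_def imageI lessThan_iff mod_less_divisor)
      then show "range (\<lambda>i. (f ^^ i) x) \<subseteq> B" by auto
    qed (auto simp: B_def)
    have inX: "(f ^^ i) x \<in> X" for i
      by (rule funpow_closed) (use psubset.prems x in auto)
    then have BX: "B \<subseteq> X" by (auto simp: B_def)
    have xB: "x \<in> B" unfolding B_eq by (rule image_eqI[of _ _ 0]) auto
    have fB: "f y \<in> B" if "y \<in> B" for y
    proof -
      obtain i where "y = (f ^^ i) x" using \<open>y \<in> B\<close> unfolding B_eq by blast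
      then have "f y = (f ^^ Suc i) x" by simp
      then show ?thesis unfolding B_eq by blast
    qed
    have fmB: "(f ^^ m) y \<in> B" if "y \<in> B" for y m
      by (rule funpow_closed) (use fB that in auto)
    \<comment> \<open>On \<open>X\<close> the map \<open>f\<close> is inverted by its iterate of
      order \<open>p - 1\<close>, so an orbit is entered only from within. Hence \<open>f\<close>
      maps \<open>X - B\<close> to itself, as the induction hypothesis requires.\<close>
    have f_preimage: "y \<in> B" if "y \<in> X" "f y \<in> B" for y
    proof -
      obtain q where "p = Suc q"
        using prime_gt_0_nat[OF p] gr0_implies_Suc by blast
      then have "(f ^^ p) y = (f ^^ q) (f y)"
        by (simp add: funpow_swap1)
      then show ?thesis using fmB[OF that(2)] psubset.prems(2)[OF that(1)] by metis
    qed
    have nofix: "f y \<noteq> y" if "y \<in> B" for y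
    proof
      assume fy: "f y = y"
      obtain i where i: "i < p" "y = (f ^^ i) x" using \<open>y \<in> B\<close> by (auto simp: B_def)
      have "(f ^^ m) y = y" for m using fy by (induction m) auto
      then have "(f ^^ (p - i)) y = y" .
      moreover have "(f ^^ (p - i)) y = (f ^^ (p - i + i)) x" unfolding funpow_add i by simp
      ultimately have "y = x" using i psubset.prems(2)[OF x(1)] by simp
      then show False using fy x by simp
    qed
    have "g ((f ^^ i) x) = g x" for i
      by (induction i) (use psubset.prems(3) inX in auto)
    then have "sum g B = int p * g x"
      using inj_on_prime_period[OF p psubset.prems(2)[OF x(1)] x(2)]
      by (simp add: B_def sum.reindex)
    then have B0: "[sum g B = 0] (mod int p)"
      by (simp add: cong_0_iff)
    have "[sum g (X - B) = sum g {y \<in> X - B. f y = y}] (mod int p)"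
      by (rule psubset.IH) (use xB x psubset.prems f_preimage in auto)
    moreover have "{y \<in> X - B. f y = y} = {y \<in> X. f y = y}"
      using nofix by auto
    moreover have "sum g X = sum g (X - B) + sum g B"
      using BX psubset.hyps by (simp add: sum.subset_diff)
    ultimately show ?thesis
      using cong_add[OF _ B0] by fastforce
  qed
qed

text \<open>Induction on the exponent: the \<open>p\<close>-th iterate of
  \<open>f ^^ (p ^ k)\<close> is the identity on \<open>X\<close>, so the sum reduces to the fixed
  points \<open>?Y\<close> of that map, where the induction hypothesis applies to
  \<open>f\<close>.\<close>

lemma sum_cong_fixpoints_prime_power:
  fixes g :: "'a \<Rightarrow> int"
  assumes p: "prime (p::nat)" and "finite X" "f ` X \<subseteq> X"
    and "\<And>x. x \<in> X \<Longrightarrow> (f ^^ (p ^ k)) x = x" and "\<And>x. x \<in> X \<Longrightarrow> g (f x) = g x"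
  shows "[sum g X = sum g {x \<in> X. f x = x}] (mod int p)"
  using assms(2-)
proof (induction k arbitrary: X)
  case 0
  then have "{x \<in> X. f x = x} = X" by auto
  then show ?case by simp
next
  case (Suc k)
  let ?h = "f ^^ (p ^ k)"
  let ?Y = "{x \<in> X. ?h x = x}"
  have inX: "(f ^^ m) x \<in> X" if "x \<in> X" for m x
    using funpow_closed Suc.prems(2) that by metis
  have ginv: "g ((f ^^ m) x) = g x" if "x \<in> X" for m x
    by (induction m) (use that Suc.prems(4) inX in auto)
  have "[sum g X = sum g ?Y] (mod int p)"
  proof (rule sum_cong_fixpoints_prime[OF p Suc.prems(1)])
    show "(?h ^^ p) x = x" if "x \<in> X" for x
      using Suc.prems(3)[OF that] by (simp add: funpow_mult mult.commute)
  qed (use inX ginv in auto)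
  also have "[sum g ?Y = sum g {x \<in> ?Y. f x = x}] (mod int p)"
  proof (rule Suc.IH)
    show "f ` ?Y \<subseteq> ?Y"
      using Suc.prems(2) by (auto simp: funpow_swap1[symmetric])
  qed (use Suc.prems in auto)
  also have "{x \<in> ?Y. f x = x} = {x \<in> X. f x = x}"
  proof -
    have "(f ^^ m) x = x" if "f x = x" for m x
      using that by (induction m) auto
    then show ?thesis by auto
  qed
  finally show ?case .
qed

text \<open>Undoes the grouping by cardinality, since orbit counting needs one summand per
  face.\<close>

lemma reduced_euler_char_eq_sum:
  assumes "finite \<Delta>"
  shows "reduced_euler_char \<Delta> = (\<Sum>F\<in>\<Delta>. (-1) ^ (card F + 1))"
proof -
  let ?I = "{0..Max (card ` \<Delta>)}"
  have "(\<Sum>F\<in>\<Delta>. (-1) ^ (card F + 1)) =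
      (\<Sum>i\<in>?I. \<Sum>F\<in>{F \<in> \<Delta>. card F = i}. (-1) ^ (card F + 1) :: int)"
    by (rule sum.group[symmetric]) (use assms in auto)
  also have "\<dots> = reduced_euler_char \<Delta>"
    unfolding reduced_euler_char_def num_faces_def by (intro sum.cong) auto
  finally show ?thesis by simp
qed

definition rotate_set :: "nat \<Rightarrow> int set \<Rightarrow> int set" where
  "rotate_set n F = (\<lambda>x. (x + 1) mod int n) ` F"

text \<open>The bound on \<open>F\<close> matters for \<open>m = 0\<close>, where reduction modulo
  \<open>n\<close> must leave \<open>F\<close> unchanged.\<close>

lemma funpow_rotate_set:
  assumes "F \<subseteq> {0..<int n}"
  shows "(rotate_set n ^^ m) F = (\<lambda>x. (x + int m) mod int n) ` F"
proof (induction m)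
  case 0
  have "(\<lambda>x. x mod int n) ` F = (\<lambda>x. x) ` F"
    by (rule image_cong) (use assms in auto)
  then show ?case by simp
next
  case (Suc m)
  then show ?case
    by (simp add: rotate_set_def image_image mod_simps ac_simps)
qed

lemma rotate_set_subset: "n > 0 \<Longrightarrow> rotate_set n F \<subseteq> {0..<int n}"
  by (auto simp: rotate_set_def)

lemma succ_mod_int:
  assumes "x \<in> {0..<int n}"
  shows "(x + 1) mod int n = (if x = int n - 1 then 0 else x + 1)"
  using assms by auto

lemma card_rotate_set:
  assumes "F \<subseteq> {0..<int n}"
  shows "card (rotate_set n F) = card F"
  unfolding rotate_set_def
proof (rule card_image, rule inj_onI)
  fix x y assume "x \<in> F" "y \<in> F" and eq: "(x + 1) mod int n = (y + 1) mod int n"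
  then have "x \<in> {0..<int n}" "y \<in> {0..<int n}"
    using assms by auto
  then show "x = y"
    using eq unfolding succ_mod_int[OF \<open>x \<in> {0..<int n}\<close>] succ_mod_int[OF \<open>y \<in> {0..<int n}\<close>]
    by (auto split: if_splits)
qed

lemma rotate_set_fixpoint:
  assumes "F \<subseteq> {0..<int n}" "rotate_set n F = F" "F \<noteq> {}"
  shows "F = {0..<int n}"
proof
  show "{0..<int n} \<subseteq> F"
  proof
    fix y assume y: "y \<in> {0..<int n}"
    obtain x where x: "x \<in> F" using assms(3) by blast
    \<comment> \<open>The summand \<open>int n\<close> keeps the number of rotations nonnegative and
      disappears modulo \<open>n\<close>.\<close>
    define m where "m = nat (y - x + int n)"
    have m: "int m = y - x + int n" using x y assms(1) by (auto simp: m_def)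
    have "(rotate_set n ^^ m) F = F"
      using assms(2) by (induction m) auto
    then have "(x + int m) mod int n \<in> F"
      using funpow_rotate_set[OF assms(1), of m] x by blast
    then show "y \<in> F" using y by (simp add: m)
  qed
qed (fact assms(1))

lemma circ_abs_minus_commute: "circ_abs n (a - b) = circ_abs n (b - a)"
  by (simp add: circ_abs_def abs_minus_commute)

text \<open>If exactly one endpoint wraps around, the distance \<open>d\<close> becomes
  \<open>n - d\<close>, and the minimum of the two is unchanged.\<close>

lemma circ_abs_succ_mod:
  assumes "i \<in> {0..<int n}" "j \<in> {0..<int n}"
  shows "circ_abs n ((j + 1) mod int n - (i + 1) mod int n) = circ_abs n (j - i)"
  using assms unfolding succ_mod_int[OF assms(1)] succ_mod_int[OF assms(2)]
  by (auto simp: circ_abs_def)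

lemma edge_circulant_graph_iff:
  assumes "i \<in> {0..<int n}" "j \<in> {0..<int n}"
  shows "{i, j} \<in> edges (circulant_graph n S) \<longleftrightarrow> circ_abs n (j - i) \<in> S"
  using assms unfolding circulant_graph_def
  by (auto simp: doubleton_eq_iff circ_abs_minus_commute[of n i j])

lemma rotate_set_independent:
  assumes "n > 0" "F \<in> independence_complex (circulant_graph n S)"
  shows "rotate_set n F \<in> independence_complex (circulant_graph n S)"
proof -
  have F: "F \<subseteq> {0..<int n}" "indep F (edges (circulant_graph n S))"
    using assms(2) by (auto simp: independence_complex_def circulant_graph_def)
  have "{(i + 1) mod int n, (j + 1) mod int n} \<in> edges (circulant_graph n S) \<longleftrightarrow>
      {i, j} \<in> edges (circulant_graph n S)" if "i \<in> F" "j \<in> F" for i j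
    using that F(1) assms(1) by (subst (1 2) edge_circulant_graph_iff) (auto simp: circ_abs_succ_mod subset_iff)
  then have "indep (rotate_set n F) (edges (circulant_graph n S))"
    using F(2) unfolding indep_def rotate_set_def by auto
  then show ?thesis
    using rotate_set_subset[OF assms(1)] by (simp add: independence_complex_def circulant_graph_def)
qed

theorem theorem2p3:
  fixes p k n :: nat and S :: "int set"
  assumes "prime p" and "k > 0" and "n = p ^ k"
    and "S \<noteq> {}" and "S \<subseteq> {1..int (n div 2)}"
  shows "reduced_euler_char (independence_complex (circulant_graph n S)) \<noteq> 0"
proof -
  let ?\<Delta> = "independence_complex (circulant_graph n S)"
  have n: "n > 0" using assms(1,3) by (simp add: prime_gt_0_nat)
  have sub: "F \<subseteq> {0..<int n}" if "F \<in> ?\<Delta>" for F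
    using that by (auto simp: independence_complex_def circulant_graph_def)
  have fin: "finite ?\<Delta>"
    by (rule finite_subset[of _ "Pow {0..<int n}"]) (use sub in auto)
  obtain s where s: "s \<in> S" "1 \<le> s" "s \<le> int (n div 2)"
    using assms(4,5) by (meson all_not_in_conv atLeastAtMost_iff subsetD)
  \<comment> \<open>As \<open>s\<close> is at most half of \<open>n\<close>, it is its own circular
    absolute value, so 0 and \<open>s\<close> are adjacent.\<close>
  have "circ_abs n (s - 0) = s" "s < int n"
    using s by (auto simp: circ_abs_def)
  then have "{0, s} \<in> edges (circulant_graph n S)"
    using s by (subst edge_circulant_graph_iff) auto
  then have full: "{0..<int n} \<notin> ?\<Delta>"
    using s \<open>s < int n\<close> unfolding independence_complex_def indep_def by force
  have fixed: "{F \<in> ?\<Delta>. rotate_set n F = F} = {{}}"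
  proof -
    have "F = {}" if "F \<in> ?\<Delta>" "rotate_set n F = F" for F
      using rotate_set_fixpoint[OF sub[OF that(1)] that(2)] full that(1) by metis
    moreover have "{} \<in> ?\<Delta>" "rotate_set n {} = {}"
      by (simp_all add: rotate_set_def independence_complex_def indep_def)
    ultimately show ?thesis by blast
  qed
  have "[(\<Sum>F\<in>?\<Delta>. (-1) ^ (card F + 1)) =
      (\<Sum>F\<in>{F \<in> ?\<Delta>. rotate_set n F = F}. (-1) ^ (card F + 1))] (mod int p)"
  proof (rule sum_cong_fixpoints_prime_power[OF assms(1) fin])
    \<comment> \<open>Rotating \<open>n\<close> times and rotating 0 times give the same image
      modulo \<open>n\<close>.\<close>
    show "(rotate_set n ^^ (p ^ k)) F = F" if "F \<in> ?\<Delta>" for F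
      using funpow_rotate_set[OF sub[OF that], of 0] funpow_rotate_set[OF sub[OF that], of n]
        assms(3) by simp
  qed (use rotate_set_independent n card_rotate_set sub in auto)
  \<comment> \<open>Only the empty face survives, with sign \<open>(-1) ^ (0 + 1)\<close>. A zero
    characteristic would then force \<open>p\<close> to divide 1.\<close>
  then have "[reduced_euler_char ?\<Delta> = - 1] (mod int p)"
    unfolding fixed reduced_euler_char_eq_sum[OF fin] by simp
  then show ?thesis
    using prime_gt_1_nat[OF assms(1)] by (auto simp: cong_iff_dvd_diff)
qed

end
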